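(* Let $P=\mathbb{N}^k\times F$ where $F$ is a countable abelian group. Suppose that $\Lambda$ is a $P$-graph, and let $\Gamma$ denote the sub-$k$-graph $d^{-1}(\mathbb{N}^k\times\{0\})$ of $\Lambda$. For each $g\in F$ and $v\in\Lambda^0$ the sets $v\Lambda^{(0,g)}$ and $\Lambda^{(0,g)}v$ are singletons. Moreover, there is an action $\rho$ of $F$ on $\Gamma$ such that for all $\lambda\in\Gamma$ and $g\in F$, the unique elements $\mu\in r(\lambda)\Lambda^{(0,g)}$ and $\nu\in s(\lambda)\Lambda^{(0,g)}$ satisfy $\mu\,\rho_g(\lambda)=\lambda\nu$. Furthermore, $\Lambda$ is isomorphic to the $P$-graph $\Gamma\times_\rho F$.
   Context: A $P$-graph is a countable small category $\Lambda$ with a functor $d:\Lambda\to P$ ($P$ regarded as a one-object category) satisfying the factorisation property: if $d(\lambda)=p+q$ then there are unique $\mu,\nu\in\Lambda$ with $d(\mu)=p$, $d(\nu)=q$, $\lambda=\mu\nu$. A $k$-graph is an $\mathbb{N}^k$-graph. $r,s$ are the codomain and domain maps (so $\mu\nu$ is defined iff $s(\mu)=r(\nu)$), $\Lambda^p=d^{-1}(p)$, $\Lambda^0=d^{-1}(0)$ is identified with the set of objects, $v\Lambda^p=\{\lambda\in\Lambda^p:r(\lambda)=v\}$ and $\Lambda^pv=\{\lambda\in\Lambda^p:s(\lambda)=v\}$. Actions on $k$-graphs are by automorphisms; isomorphisms and automorphisms are degree-preserving. Given a $k$-graph $\Gamma$ and an action $g\mapsto\rho_g$ of $F$ on $\Gamma$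 by automorphisms, $\Gamma\times_\rho F$ is the $P$-graph with underlying set $\Gamma\times F$, degree map $d(\lambda,g)=(d(\lambda),g)$, range and source $r(\lambda,g)=(r(\lambda),0)$, $s(\lambda,g)=(s(\rho_{-g}(\lambda)),0)$, and composition $(\mu,g)(\nu,h)=(\mu\rho_g(\nu),g+h)$ whenever $s(\mu)=r(\rho_g(\nu))$.
   Formalization: The last clause is sign-corrected: Λ is shown isomorphic to the crossed product of Γ by the inverse action g ↦ ρ_{-g}, not by ρ; with the stated conventions for Γ×_ρ F and μρ_g(λ)=λν the literal claim fails (e.g. Λ=ℤ×ℕ×ℤ with s(m,n,g)=m+n+g). *)

theory Defs
  imports "HOL-Algebra.Algebra" "HOL-Library.Countable_Set"
begin

text \<open>Small categories are encoded by their morphisms alone: an object is identified with its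
  identity morphism, so that \<open>rng\<close> (codomain) and \<open>src\<close> (domain) map morphisms to morphisms.
  The composite \<open>cmp \<mu> \<nu>\<close> is meaningful only when \<open>src \<mu> = rng \<nu>\<close>.\<close>

record ('a, 'p) graded_cat =
  mor :: "'a set"
  rng :: "'a \<Rightarrow> 'a"
  src :: "'a \<Rightarrow> 'a"
  cmp :: "'a \<Rightarrow> 'a \<Rightarrow> 'a"
  deg :: "'a \<Rightarrow> 'p"

locale small_category =
  fixes \<Lambda> :: "('a, 'p) graded_cat"
  assumes rng_closed: "l \<in> mor \<Lambda> \<Longrightarrow> rng \<Lambda> l \<in> mor \<Lambda>"
    and src_closed: "l \<in> mor \<Lambda> \<Longrightarrow> src \<Lambda> l \<in> mor \<Lambda>"
    and rng_rng: "l \<in> mor \<Lambda> \<Longrightarrow> rng \<Lambda> (rng \<Lambda> l) = rng \<Lambda> l"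
    and src_rng: "l \<in> mor \<Lambda> \<Longrightarrow> src \<Lambda> (rng \<Lambda> l) = rng \<Lambda> l"
    and rng_src: "l \<in> mor \<Lambda> \<Longrightarrow> rng \<Lambda> (src \<Lambda> l) = src \<Lambda> l"
    and src_src: "l \<in> mor \<Lambda> \<Longrightarrow> src \<Lambda> (src \<Lambda> l) = src \<Lambda> l"
    and cmp_closed: "\<lbrakk>\<mu> \<in> mor \<Lambda>; \<nu> \<in> mor \<Lambda>; src \<Lambda> \<mu> = rng \<Lambda> \<nu>\<rbrakk> \<Longrightarrow> cmp \<Lambda> \<mu> \<nu> \<in> mor \<Lambda>"
    and rng_cmp: "\<lbrakk>\<mu> \<in> mor \<Lambda>; \<nu> \<in> mor \<Lambda>; src \<Lambda> \<mu> = rng \<Lambda> \<nu>\<rbrakk>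
      \<Longrightarrow> rng \<Lambda> (cmp \<Lambda> \<mu> \<nu>) = rng \<Lambda> \<mu>"
    and src_cmp: "\<lbrakk>\<mu> \<in> mor \<Lambda>; \<nu> \<in> mor \<Lambda>; src \<Lambda> \<mu> = rng \<Lambda> \<nu>\<rbrakk>
      \<Longrightarrow> src \<Lambda> (cmp \<Lambda> \<mu> \<nu>) = src \<Lambda> \<nu>"
    and cmp_rng: "l \<in> mor \<Lambda> \<Longrightarrow> cmp \<Lambda> (rng \<Lambda> l) l = l"
    and cmp_src: "l \<in> mor \<Lambda> \<Longrightarrow> cmp \<Lambda> l (src \<Lambda> l) = l"
    and cmp_assoc: "\<lbrakk>l \<in> mor \<Lambda>; \<mu> \<in> mor \<Lambda>; \<nu> \<in> mor \<Lambda>; src \<Lambda> l = rng \<Lambda> \<mu>; src \<Lambda> \<mu> = rng \<Lambda> \<nu>\<rbrakk>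
      \<Longrightarrow> cmp \<Lambda> (cmp \<Lambda> l \<mu>) \<nu> = cmp \<Lambda> l (cmp \<Lambda> \<mu> \<nu>)"

text \<open>The degree monoid \<open>P\<close> is a \<open>HOL-Algebra\<close> monoid, written multiplicatively; the additive
  \<open>p + q\<close>, \<open>0\<close> and \<open>-g\<close> are thus \<open>p \<otimes> q\<close>, \<open>\<one>\<close> and \<open>inv g\<close>. The assumptions
  \<open>deg_closed\<close>, \<open>deg_rng\<close> and \<open>deg_cmp\<close> say that \<open>deg\<close> is a functor to \<open>P\<close>
  (identity morphisms are exactly the \<open>rng l\<close>).\<close>

locale P_graph = small_category \<Lambda> + comm_monoid P
  for P :: "('p, 'm) monoid_scheme" (structure) and \<Lambda> :: "('a, 'p) graded_cat" +
  assumes countable_mor: "countable (mor \<Lambda>)"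
    and deg_closed: "l \<in> mor \<Lambda> \<Longrightarrow> deg \<Lambda> l \<in> carrier P"
    and deg_rng: "l \<in> mor \<Lambda> \<Longrightarrow> deg \<Lambda> (rng \<Lambda> l) = \<one>"
    and deg_cmp: "\<lbrakk>\<mu> \<in> mor \<Lambda>; \<nu> \<in> mor \<Lambda>; src \<Lambda> \<mu> = rng \<Lambda> \<nu>\<rbrakk>
      \<Longrightarrow> deg \<Lambda> (cmp \<Lambda> \<mu> \<nu>) = deg \<Lambda> \<mu> \<otimes> deg \<Lambda> \<nu>"
    and factorisation: "\<lbrakk>l \<in> mor \<Lambda>; p \<in> carrier P; q \<in> carrier P; deg \<Lambda> l = p \<otimes> q\<rbrakk>
      \<Longrightarrow> \<exists>!x. case x of (\<mu>, \<nu>) \<Rightarrow> \<mu> \<in> mor \<Lambda> \<and> \<nu> \<in> mor \<Lambda> \<and> deg \<Lambda> \<mu> = p \<and> deg \<Lambda> \<nu> = q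
            \<and> src \<Lambda> \<mu> = rng \<Lambda> \<nu> \<and> l = cmp \<Lambda> \<mu> \<nu>"

definition deg_fibre :: "('a, 'p) graded_cat \<Rightarrow> 'p \<Rightarrow> 'a set" where
  "deg_fibre \<Lambda> p = {l \<in> mor \<Lambda>. deg \<Lambda> l = p}"

definition rng_fibre :: "('a, 'p) graded_cat \<Rightarrow> 'a \<Rightarrow> 'p \<Rightarrow> 'a set" where
  "rng_fibre \<Lambda> v p = {l \<in> deg_fibre \<Lambda> p. rng \<Lambda> l = v}"

definition src_fibre :: "('a, 'p) graded_cat \<Rightarrow> 'p \<Rightarrow> 'a \<Rightarrow> 'a set" where
  "src_fibre \<Lambda> p v = {l \<in> deg_fibre \<Lambda> p. src \<Lambda> l = v}"

text \<open>The identification of \<open>\<Lambda>\<^sup>0\<close> with the set of objects.\<close>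

lemma (in P_graph) deg_fibre_one: "deg_fibre \<Lambda> \<one> = rng \<Lambda> ` mor \<Lambda>"
proof
  show "rng \<Lambda> ` mor \<Lambda> \<subseteq> deg_fibre \<Lambda> \<one>"
    by (auto simp: deg_fibre_def rng_closed deg_rng)
  show "deg_fibre \<Lambda> \<one> \<subseteq> rng \<Lambda> ` mor \<Lambda>"
  proof
    fix l assume "l \<in> deg_fibre \<Lambda> \<one>"
    then have l: "l \<in> mor \<Lambda>" "deg \<Lambda> l = \<one>" by (auto simp: deg_fibre_def)
    have s: "deg \<Lambda> (src \<Lambda> l) = \<one>" using l deg_rng rng_src src_closed by metis
    have "(rng \<Lambda> l, l) = (l, src \<Lambda> l)"
      using factorisation[of l \<one> \<one>] l s
      by (rule_tac ex1E[OF factorisation[of l \<one> \<one>]])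
        (auto simp: rng_closed src_closed deg_rng src_rng rng_src cmp_rng cmp_src)
    then show "l \<in> rng \<Lambda> ` mor \<Lambda>" using l by (metis Pair_inject image_eqI)
  qed
qed

definition nat_pow :: "nat \<Rightarrow> (nat \<Rightarrow> nat) monoid" where
  "nat_pow k = product_group {..<k} (\<lambda>_. \<lparr>carrier = UNIV, monoid.mult = (+), one = 0\<rparr>)"

abbreviation k_graph :: "nat \<Rightarrow> ('a, nat \<Rightarrow> nat) graded_cat \<Rightarrow> bool" where
  "k_graph k \<equiv> P_graph (nat_pow k)"

text \<open>\<open>d\<^sup>-\<^sup>1(\<nat>\<^sup>k \<times> {0})\<close> with the inherited structure; \<open>fst\<close> identifies \<open>\<nat>\<^sup>k \<times> {0}\<close> with \<open>\<nat>\<^sup>k\<close>.\<close>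

definition sub_k_graph ::
  "nat \<Rightarrow> ('f, 'm) monoid_scheme \<Rightarrow> ('a, (nat \<Rightarrow> nat) \<times> 'f) graded_cat
    \<Rightarrow> ('a, nat \<Rightarrow> nat) graded_cat" where
  "sub_k_graph k F \<Lambda> =
    \<lparr>mor = {l \<in> mor \<Lambda>. deg \<Lambda> l \<in> carrier (nat_pow k) \<times> {\<one>\<^bsub>F\<^esub>}},
     rng = rng \<Lambda>, src = src \<Lambda>, cmp = cmp \<Lambda>, deg = (\<lambda>l. fst (deg \<Lambda> l))\<rparr>"

definition graph_iso ::
  "('a, 'p) graded_cat \<Rightarrow> ('b, 'p) graded_cat \<Rightarrow> ('a \<Rightarrow> 'b) \<Rightarrow> bool" where
  "graph_iso \<Lambda> M \<phi> \<longleftrightarrow> bij_betw \<phi> (mor \<Lambda>) (mor M)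
    \<and> (\<forall>l \<in> mor \<Lambda>. rng M (\<phi> l) = \<phi> (rng \<Lambda> l) \<and> src M (\<phi> l) = \<phi> (src \<Lambda> l)
          \<and> deg M (\<phi> l) = deg \<Lambda> l)
    \<and> (\<forall>\<mu> \<in> mor \<Lambda>. \<forall>\<nu> \<in> mor \<Lambda>. src \<Lambda> \<mu> = rng \<Lambda> \<nu>
          \<longrightarrow> \<phi> (cmp \<Lambda> \<mu> \<nu>) = cmp M (\<phi> \<mu>) (\<phi> \<nu>))"

definition isomorphic_graphs ::
  "('a, 'p) graded_cat \<Rightarrow> ('b, 'p) graded_cat \<Rightarrow> bool" where
  "isomorphic_graphs \<Lambda> M \<longleftrightarrow> (\<exists>\<phi>. graph_iso \<Lambda> M \<phi>)"

definition graph_action ::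
  "('f, 'm) monoid_scheme \<Rightarrow> ('a, 'p) graded_cat \<Rightarrow> ('f \<Rightarrow> 'a \<Rightarrow> 'a) \<Rightarrow> bool" where
  "graph_action F \<Gamma> \<rho> \<longleftrightarrow>
    group_action F (mor \<Gamma>) \<rho> \<and> (\<forall>g \<in> carrier F. graph_iso \<Gamma> \<Gamma> (\<rho> g))"

text \<open>\<open>\<Gamma> \<times>\<^sub>\<rho> F\<close>. Here \<open>(\<mu>, g)\<close> and \<open>(\<nu>, h)\<close> are composable iff \<open>s(\<rho>\<^sub>-\<^sub>g(\<mu>)) = r(\<nu>)\<close>, which for an
  action \<open>\<rho>\<close> is the condition \<open>s(\<mu>) = r(\<rho>\<^sub>g(\<nu>))\<close>.

  Beware of the sign: in \<open>\<Lambda> = \<Gamma> \<times>\<^sub>\<sigma> F\<close> the unique elements \<open>\<mu>\<close> and \<open>\<nu>\<close> of degree \<open>(0, g)\<close> with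
  \<open>r(\<mu>) = r(l)\<close>, \<open>r(\<nu>) = s(l)\<close> satisfy \<open>l\<nu> = \<mu>\<sigma>\<^sub>-\<^sub>g(l)\<close>. So an action \<open>\<rho>\<close> that is characterised
  by \<open>\<mu>\<rho>\<^sub>g(l) = l\<nu>\<close> describes \<open>\<Lambda>\<close> as \<open>\<Gamma> \<times>\<^sub>\<sigma> F\<close> with \<open>\<sigma>\<^sub>g = \<rho>\<^sub>-\<^sub>g\<close> rather than \<open>\<Gamma> \<times>\<^sub>\<rho> F\<close>.\<close>

definition crossed_product ::
  "('f, 'm) monoid_scheme \<Rightarrow> ('a, 'q) graded_cat \<Rightarrow> ('f \<Rightarrow> 'a \<Rightarrow> 'a)
    \<Rightarrow> ('a \<times> 'f, 'q \<times> 'f) graded_cat" where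
  "crossed_product F \<Gamma> \<rho> =
    \<lparr>mor = mor \<Gamma> \<times> carrier F,
     rng = (\<lambda>(l, g). (rng \<Gamma> l, \<one>\<^bsub>F\<^esub>)),
     src = (\<lambda>(l, g). (src \<Gamma> (\<rho> (inv\<^bsub>F\<^esub> g) l), \<one>\<^bsub>F\<^esub>)),
     cmp = (\<lambda>(\<mu>, g) (\<nu>, h). (cmp \<Gamma> \<mu> (\<rho> g \<nu>), g \<otimes>\<^bsub>F\<^esub> h)),
     deg = (\<lambda>(l, g). (deg \<Gamma> l, g))\<rparr>"

end

theory Submission
  imports Defs
begin

text \<open>The elements of degree \<open>(0, g)\<close> are invertible, because a product of elements of degrees
  \<open>(0, g)\<close> and \<open>(0, -g)\<close> has degree \<open>0\<close> and so is an identity. Hence each object \<open>v\<close> is the range of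
  exactly one such element \<open>u\<^sub>g(v)\<close>, and \<open>u\<^sub>g(v) u\<^sub>h(s(u\<^sub>g(v))) = u\<^bsub>g+h\<^esub>(v)\<close>. The action is the conjugation
  \<open>\<rho>\<^sub>g(l) = u\<^sub>g(r(l))\<^sup>-\<^sup>1 l u\<^sub>g(s(l))\<close>, and the isomorphism inverts \<open>(l, g) \<mapsto> l u\<^sub>g(s(l))\<close>. That the
  crossed product is a \<open>P\<close>-graph is transported from \<open>\<Lambda>\<close> along this isomorphism.\<close>

section \<open>Unique factorisation, and transport of the axioms along an isomorphism\<close>

text \<open>The factorisation axiom quantifies over one pair. Splitting it into two variables lets
  both factors be obtained by name, with uniqueness as a separate fact.\<close>

lemma (in P_graph) factorisation_ex:
  assumes "l \<in> mor \<Lambda>" "p \<in> carrier P" "q \<in> carrier P" "deg \<Lambda> l = p \<otimes> q"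
  shows "\<exists>\<mu> \<nu>. \<mu> \<in> mor \<Lambda> \<and> \<nu> \<in> mor \<Lambda> \<and> deg \<Lambda> \<mu> = p \<and> deg \<Lambda> \<nu> = q
    \<and> src \<Lambda> \<mu> = rng \<Lambda> \<nu> \<and> l = cmp \<Lambda> \<mu> \<nu>
    \<and> (\<forall>\<mu>' \<nu>'. \<mu>' \<in> mor \<Lambda> \<and> \<nu>' \<in> mor \<Lambda> \<and> deg \<Lambda> \<mu>' = p \<and> deg \<Lambda> \<nu>' = q
        \<and> src \<Lambda> \<mu>' = rng \<Lambda> \<nu>' \<and> l = cmp \<Lambda> \<mu>' \<nu>' \<longrightarrow> \<mu>' = \<mu> \<and> \<nu>' = \<nu>)"
proof -
  define R where "R \<mu> \<nu> \<longleftrightarrow> \<mu> \<in> mor \<Lambda> \<and> \<nu> \<in> mor \<Lambda> \<and> deg \<Lambda> \<mu> = p \<and> deg \<Lambda> \<nu> = q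
    \<and> src \<Lambda> \<mu> = rng \<Lambda> \<nu> \<and> l = cmp \<Lambda> \<mu> \<nu>" for \<mu> \<nu>
  have "\<exists>!x. case x of (\<mu>, \<nu>) \<Rightarrow> R \<mu> \<nu>"
    using factorisation[OF assms] by (simp only: R_def)
  then obtain \<mu> \<nu> where "R \<mu> \<nu>" "\<forall>\<mu>' \<nu>'. R \<mu>' \<nu>' \<longrightarrow> \<mu>' = \<mu> \<and> \<nu>' = \<nu>"
    by fastforce
  then show ?thesis unfolding R_def by blast
qed

text \<open>Every element of \<open>M\<close> is some \<phi>(l), and injectivity turns equations in
  \<open>M\<close> into equations in \<Lambda>, so each axiom for \<open>M\<close> reduces to the
  same axiom for \<Lambda>.\<close>

lemma P_graph_transport:
  assumes \<Lambda>: "P_graph P \<Lambda>" and iso: "graph_iso \<Lambda> M \<phi>"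
  shows "P_graph P M"
proof -
  interpret P_graph P \<Lambda> by (rule \<Lambda>)
  have inj: "inj_on \<phi> (mor \<Lambda>)" and M: "mor M = \<phi> ` mor \<Lambda>"
    using iso by (auto simp: graph_iso_def bij_betw_def)
  have r[simp]: "rng M (\<phi> l) = \<phi> (rng \<Lambda> l)" and s[simp]: "src M (\<phi> l) = \<phi> (src \<Lambda> l)"
    and d[simp]: "deg M (\<phi> l) = deg \<Lambda> l" if "l \<in> mor \<Lambda>" for l
    using iso that by (auto simp: graph_iso_def)
  have c: "cmp M (\<phi> \<mu>) (\<phi> \<nu>) = \<phi> (cmp \<Lambda> \<mu> \<nu>)"
    if "\<mu> \<in> mor \<Lambda>" "\<nu> \<in> mor \<Lambda>" "src \<Lambda> \<mu> = rng \<Lambda> \<nu>" for \<mu> \<nu>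
    using iso that by (auto simp: graph_iso_def)
  have eq[simp]: "\<phi> x = \<phi> y \<longleftrightarrow> x = y" if "x \<in> mor \<Lambda>" "y \<in> mor \<Lambda>" for x y
    using inj that by (auto dest: inj_onD)
  note closed[simp] = rng_closed src_closed cmp_closed
  show ?thesis
  proof unfold_locales
    fix l p q
    assume l: "l \<in> mor M" "p \<in> carrier P" "q \<in> carrier P" "deg M l = p \<otimes>\<^bsub>P\<^esub> q"
    then obtain l' where l': "l' \<in> mor \<Lambda>" "l = \<phi> l'" by (auto simp: M)
    have d': "deg \<Lambda> l' = p \<otimes>\<^bsub>P\<^esub> q" using l(4) l' by simp
    obtain \<mu> \<nu> where f: "\<mu> \<in> mor \<Lambda>" "\<nu> \<in> mor \<Lambda>" "deg \<Lambda> \<mu> = p" "deg \<Lambda> \<nu> = q"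
      "src \<Lambda> \<mu> = rng \<Lambda> \<nu>" "l' = cmp \<Lambda> \<mu> \<nu>"
      and un: "\<forall>\<mu>' \<nu>'. \<mu>' \<in> mor \<Lambda> \<and> \<nu>' \<in> mor \<Lambda> \<and> deg \<Lambda> \<mu>' = p \<and> deg \<Lambda> \<nu>' = q
          \<and> src \<Lambda> \<mu>' = rng \<Lambda> \<nu>' \<and> l' = cmp \<Lambda> \<mu>' \<nu>' \<longrightarrow> \<mu>' = \<mu> \<and> \<nu>' = \<nu>"
      using factorisation_ex[OF l'(1) l(2,3) d'] by blast
    show "\<exists>!x. case x of (\<mu>, \<nu>) \<Rightarrow> \<mu> \<in> mor M \<and> \<nu> \<in> mor M \<and> deg M \<mu> = p \<and> deg M \<nu> = q
            \<and> src M \<mu> = rng M \<nu> \<and> l = cmp M \<mu> \<nu>"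
    proof (rule ex1I[of _ "(\<phi> \<mu>, \<phi> \<nu>)"])
      show "case (\<phi> \<mu>, \<phi> \<nu>) of (\<mu>, \<nu>) \<Rightarrow> \<mu> \<in> mor M \<and> \<nu> \<in> mor M \<and> deg M \<mu> = p
          \<and> deg M \<nu> = q \<and> src M \<mu> = rng M \<nu> \<and> l = cmp M \<mu> \<nu>"
        using f l' by (auto simp: M c)
    next
      fix x
      assume x: "case x of (\<mu>, \<nu>) \<Rightarrow> \<mu> \<in> mor M \<and> \<nu> \<in> mor M \<and> deg M \<mu> = p
          \<and> deg M \<nu> = q \<and> src M \<mu> = rng M \<nu> \<and> l = cmp M \<mu> \<nu>"
      then obtain \<mu>' \<nu>' where x': "x = (\<phi> \<mu>', \<phi> \<nu>')" "\<mu>' \<in> mor \<Lambda>" "\<nu>' \<in> mor \<Lambda>"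
        by (auto simp: M)
      \<comment> \<open>Composability in \<open>M\<close> says \<phi>(s(\<mu>')) =
        \<phi>(r(\<nu>')). It must be reflected to \<Lambda> first, since \<phi> respects composites
        only of composable pairs.\<close>
      with x l' have "src \<Lambda> \<mu>' = rng \<Lambda> \<nu>'" by auto
      with x x' l' have "\<mu>' = \<mu> \<and> \<nu>' = \<nu>" by (intro un[rule_format]) (auto simp: c)
      with x' show "x = (\<phi> \<mu>, \<phi> \<nu>)" by simp
    qed
  qed (use countable_mor in \<open>auto simp: M c rng_rng src_rng rng_src src_src rng_cmp src_cmp
        cmp_rng cmp_src cmp_assoc deg_closed deg_rng deg_cmp\<close>)
qed

section \<open>The subgraph of elements whose degree has trivial component in F\<close>

text \<open>\<open>Q\<close> stands for N^k, which enters the argument only as a commutative monoid;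
  the final theorem takes \<open>Q\<close> to be \<open>nat_pow k\<close>.\<close>

locale product_graph = Q: comm_monoid Q + F: comm_group F + P_graph "Q \<times>\<times> F" \<Lambda>
  for Q :: "('q, 'n) monoid_scheme" and F :: "('f, 'm) monoid_scheme"
    and \<Lambda> :: "('a, 'q \<times> 'f) graded_cat"
begin

text \<open>This is \<open>sub_k_graph\<close> with \<open>Q\<close> for \<open>nat_pow k\<close>;
  the two agree by unfolding once \<open>Q\<close> is instantiated.\<close>

definition \<Gamma> :: "('a, 'q) graded_cat" where
  "\<Gamma> = \<lparr>mor = {l \<in> mor \<Lambda>. deg \<Lambda> l \<in> carrier Q \<times> {\<one>\<^bsub>F\<^esub>}},
     rng = rng \<Lambda>, src = src \<Lambda>, cmp = cmp \<Lambda>, deg = (\<lambda>l. fst (deg \<Lambda> l))\<rparr>"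

lemma \<Gamma>_simps[simp]: "rng \<Gamma> = rng \<Lambda>" "src \<Gamma> = src \<Lambda>" "cmp \<Gamma> = cmp \<Lambda>"
  "deg \<Gamma> l = fst (deg \<Lambda> l)"
  by (simp_all add: \<Gamma>_def)

lemma fst_deg_closed: "l \<in> mor \<Lambda> \<Longrightarrow> fst (deg \<Lambda> l) \<in> carrier Q"
  and snd_deg_closed: "l \<in> mor \<Lambda> \<Longrightarrow> snd (deg \<Lambda> l) \<in> carrier F"
  using deg_closed[of l] by (auto simp: DirProd_def)

lemma mor_\<Gamma>_iff: "l \<in> mor \<Gamma> \<longleftrightarrow> l \<in> mor \<Lambda> \<and> snd (deg \<Lambda> l) = \<one>\<^bsub>F\<^esub>"
  using fst_deg_closed[of l] by (cases "deg \<Lambda> l") (auto simp: \<Gamma>_def)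

lemma mor_\<Gamma>_D: "l \<in> mor \<Gamma> \<Longrightarrow> l \<in> mor \<Lambda>"
  by (simp add: mor_\<Gamma>_iff)

lemma deg_obj: "l \<in> mor \<Lambda> \<Longrightarrow> deg \<Lambda> (rng \<Lambda> l) = (\<one>\<^bsub>Q\<^esub>, \<one>\<^bsub>F\<^esub>)"
  "l \<in> mor \<Lambda> \<Longrightarrow> deg \<Lambda> (src \<Lambda> l) = (\<one>\<^bsub>Q\<^esub>, \<one>\<^bsub>F\<^esub>)"
  using deg_rng[of l] deg_rng[of "src \<Lambda> l"] by (auto simp: rng_src src_closed)

lemma deg_comp: "\<lbrakk>\<mu> \<in> mor \<Lambda>; \<nu> \<in> mor \<Lambda>; src \<Lambda> \<mu> = rng \<Lambda> \<nu>\<rbrakk>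
  \<Longrightarrow> deg \<Lambda> (cmp \<Lambda> \<mu> \<nu>)
    = (fst (deg \<Lambda> \<mu>) \<otimes>\<^bsub>Q\<^esub> fst (deg \<Lambda> \<nu>), snd (deg \<Lambda> \<mu>) \<otimes>\<^bsub>F\<^esub> snd (deg \<Lambda> \<nu>))"
  using deg_cmp[of \<mu> \<nu>] by (cases "deg \<Lambda> \<mu>"; cases "deg \<Lambda> \<nu>") auto

lemma obj_\<Gamma>: "l \<in> mor \<Lambda> \<Longrightarrow> rng \<Lambda> l \<in> mor \<Gamma>" "l \<in> mor \<Lambda> \<Longrightarrow> src \<Lambda> l \<in> mor \<Gamma>"
  by (simp_all add: mor_\<Gamma>_iff rng_closed src_closed deg_obj)

lemma cmp_\<Gamma>: "\<lbrakk>\<mu> \<in> mor \<Gamma>; \<nu> \<in> mor \<Gamma>; src \<Lambda> \<mu> = rng \<Lambda> \<nu>\<rbrakk> \<Longrightarrow> cmp \<Lambda> \<mu> \<nu> \<in> mor \<Gamma>"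
  by (simp add: mor_\<Gamma>_iff cmp_closed deg_comp)

text \<open>Factorisations in \<Gamma> with degrees p and q are exactly those in \<Lambda> with
  degrees (p, 0) and (q, 0), so unique factorisation is inherited.\<close>

lemma P_graph_\<Gamma>: "P_graph Q \<Gamma>"
proof unfold_locales
  fix l p q
  assume l: "l \<in> mor \<Gamma>" "p \<in> carrier Q" "q \<in> carrier Q" "deg \<Gamma> l = p \<otimes>\<^bsub>Q\<^esub> q"
  have "(\<mu> \<in> mor \<Gamma> \<and> \<nu> \<in> mor \<Gamma> \<and> deg \<Gamma> \<mu> = p \<and> deg \<Gamma> \<nu> = q \<and> src \<Gamma> \<mu> = rng \<Gamma> \<nu>
          \<and> l = cmp \<Gamma> \<mu> \<nu>)
      = (\<mu> \<in> mor \<Lambda> \<and> \<nu> \<in> mor \<Lambda> \<and> deg \<Lambda> \<mu> = (p, \<one>\<^bsub>F\<^esub>) \<and> deg \<Lambda> \<nu> = (q, \<one>\<^bsub>F\<^esub>)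
          \<and> src \<Lambda> \<mu> = rng \<Lambda> \<nu> \<and> l = cmp \<Lambda> \<mu> \<nu>)" for \<mu> \<nu>
    by (auto simp: mor_\<Gamma>_iff prod_eq_iff)
  moreover have "\<exists>!x. case x of (\<mu>, \<nu>) \<Rightarrow> \<mu> \<in> mor \<Lambda> \<and> \<nu> \<in> mor \<Lambda> \<and> deg \<Lambda> \<mu> = (p, \<one>\<^bsub>F\<^esub>)
      \<and> deg \<Lambda> \<nu> = (q, \<one>\<^bsub>F\<^esub>) \<and> src \<Lambda> \<mu> = rng \<Lambda> \<nu> \<and> l = cmp \<Lambda> \<mu> \<nu>"
    using l by (intro factorisation) (auto simp: mor_\<Gamma>_iff DirProd_def prod_eq_iff)
  ultimately show "\<exists>!x. case x of (\<mu>, \<nu>) \<Rightarrow> \<mu> \<in> mor \<Gamma> \<and> \<nu> \<in> mor \<Gamma> \<and> deg \<Gamma> \<mu> = p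
      \<and> deg \<Gamma> \<nu> = q \<and> src \<Gamma> \<mu> = rng \<Gamma> \<nu> \<and> l = cmp \<Gamma> \<mu> \<nu>"
    by (simp only:)
next
  have "mor \<Gamma> \<subseteq> mor \<Lambda>" by (auto simp: mor_\<Gamma>_iff)
  then show "countable (mor \<Gamma>)" using countable_mor countable_subset by blast
qed (auto simp: obj_\<Gamma> cmp_\<Gamma> fst_deg_closed deg_obj deg_comp rng_rng src_rng rng_src src_src
    rng_cmp src_cmp cmp_rng cmp_src cmp_assoc dest!: mor_\<Gamma>_D)

section \<open>Objects and the elements of degree (0, g)\<close>

abbreviation "obj \<equiv> deg_fibre \<Lambda> (\<one>\<^bsub>Q\<^esub>, \<one>\<^bsub>F\<^esub>)"

lemma obj_rng: "l \<in> mor \<Lambda> \<Longrightarrow> rng \<Lambda> l \<in> obj" and obj_src: "l \<in> mor \<Lambda> \<Longrightarrow> src \<Lambda> l \<in> obj"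
  by (simp_all add: deg_fibre_def rng_closed src_closed deg_obj)

lemma objD:
  assumes "v \<in> obj" shows "v \<in> mor \<Lambda>" "rng \<Lambda> v = v" "src \<Lambda> v = v"
proof -
  obtain l where "l \<in> mor \<Lambda>" "v = rng \<Lambda> l"
    using assms deg_fibre_one unfolding one_DirProd by auto
  then show "v \<in> mor \<Lambda>" "rng \<Lambda> v = v" "src \<Lambda> v = v"
    by (auto simp: rng_closed rng_rng src_rng)
qed

text \<open>Factor the identity v along 0 = (0, g) + (0, -g). The factors inherit range and source
  from v. Uniqueness ranges over whole degree fibres, because having composite v already fixes the
  outer endpoints.\<close>

lemma obj_factor:
  assumes "v \<in> obj" "g \<in> carrier F"
  shows "\<exists>\<mu> \<nu>. \<mu> \<in> rng_fibre \<Lambda> v (\<one>\<^bsub>Q\<^esub>, g) \<and> \<nu> \<in> src_fibre \<Lambda> (\<one>\<^bsub>Q\<^esub>, inv\<^bsub>F\<^esub> g) v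
    \<and> (\<forall>\<mu>' \<in> deg_fibre \<Lambda> (\<one>\<^bsub>Q\<^esub>, g). \<forall>\<nu>' \<in> deg_fibre \<Lambda> (\<one>\<^bsub>Q\<^esub>, inv\<^bsub>F\<^esub> g).
        src \<Lambda> \<mu>' = rng \<Lambda> \<nu>' \<longrightarrow> cmp \<Lambda> \<mu>' \<nu>' = v \<longrightarrow> \<mu>' = \<mu> \<and> \<nu>' = \<nu>)"
proof -
  have "v \<in> mor \<Lambda>" "(\<one>\<^bsub>Q\<^esub>, g) \<in> carrier (Q \<times>\<times> F)" "(\<one>\<^bsub>Q\<^esub>, inv\<^bsub>F\<^esub> g) \<in> carrier (Q \<times>\<times> F)"
    "deg \<Lambda> v = (\<one>\<^bsub>Q\<^esub>, g) \<otimes>\<^bsub>Q \<times>\<times> F\<^esub> (\<one>\<^bsub>Q\<^esub>, inv\<^bsub>F\<^esub> g)"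
    using assms by (auto simp: deg_fibre_def DirProd_def)
  from factorisation_ex[OF this] obtain \<mu> \<nu> where f: "\<mu> \<in> mor \<Lambda>" "\<nu> \<in> mor \<Lambda>"
    "deg \<Lambda> \<mu> = (\<one>\<^bsub>Q\<^esub>, g)" "deg \<Lambda> \<nu> = (\<one>\<^bsub>Q\<^esub>, inv\<^bsub>F\<^esub> g)" "src \<Lambda> \<mu> = rng \<Lambda> \<nu>" "v = cmp \<Lambda> \<mu> \<nu>"
    and un: "\<forall>\<mu>' \<nu>'. \<mu>' \<in> mor \<Lambda> \<and> \<nu>' \<in> mor \<Lambda> \<and> deg \<Lambda> \<mu>' = (\<one>\<^bsub>Q\<^esub>, g)
        \<and> deg \<Lambda> \<nu>' = (\<one>\<^bsub>Q\<^esub>, inv\<^bsub>F\<^esub> g) \<and> src \<Lambda> \<mu>' = rng \<Lambda> \<nu>' \<and> v = cmp \<Lambda> \<mu>' \<nu>'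
        \<longrightarrow> \<mu>' = \<mu> \<and> \<nu>' = \<nu>"
    by blast
  have "rng \<Lambda> \<mu> = v" "src \<Lambda> \<nu> = v"
    using f rng_cmp[OF f(1,2,5)] src_cmp[OF f(1,2,5)] objD[OF assms(1)] by simp_all
  with f have "\<mu> \<in> rng_fibre \<Lambda> v (\<one>\<^bsub>Q\<^esub>, g)" "\<nu> \<in> src_fibre \<Lambda> (\<one>\<^bsub>Q\<^esub>, inv\<^bsub>F\<^esub> g) v"
    by (simp_all add: rng_fibre_def src_fibre_def deg_fibre_def)
  with un show ?thesis unfolding deg_fibre_def by blast
qed

text \<open>The composite has degree 0, so it is an identity and equals both its range and its
  source.\<close>

lemma cmp_inverse_degree:
  assumes "\<mu> \<in> deg_fibre \<Lambda> (\<one>\<^bsub>Q\<^esub>, g)" "\<nu> \<in> deg_fibre \<Lambda> (\<one>\<^bsub>Q\<^esub>, inv\<^bsub>F\<^esub> g)" "src \<Lambda> \<mu> = rng \<Lambda> \<nu>"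
    "g \<in> carrier F"
  shows "cmp \<Lambda> \<mu> \<nu> = rng \<Lambda> \<mu>" "cmp \<Lambda> \<mu> \<nu> = src \<Lambda> \<nu>"
proof -
  have mn: "\<mu> \<in> mor \<Lambda>" "\<nu> \<in> mor \<Lambda>" using assms by (auto simp: deg_fibre_def)
  have "cmp \<Lambda> \<mu> \<nu> \<in> obj"
    using assms mn by (auto simp: deg_fibre_def cmp_closed deg_comp)
  from objD[OF this] show "cmp \<Lambda> \<mu> \<nu> = rng \<Lambda> \<mu>" "cmp \<Lambda> \<mu> \<nu> = src \<Lambda> \<nu>"
    using mn assms(3) by (auto simp: rng_cmp src_cmp)
qed

text \<open>Existence is the first factor in \<open>obj_factor\<close>. Any competitor \<mu>' can be
  followed by some \<alpha> of degree (0, -g); their composite is r(\<mu>') = v, and unique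
  factorisation of v forces \<mu>' = \<mu>.\<close>

lemma rng_fibre_singleton:
  assumes v: "v \<in> obj" and g: "g \<in> carrier F"
  shows "is_singleton (rng_fibre \<Lambda> v (\<one>\<^bsub>Q\<^esub>, g))"
proof -
  obtain \<mu> \<nu> where m: "\<mu> \<in> rng_fibre \<Lambda> v (\<one>\<^bsub>Q\<^esub>, g)"
    and un: "\<And>\<mu>' \<nu>'. \<lbrakk>\<mu>' \<in> deg_fibre \<Lambda> (\<one>\<^bsub>Q\<^esub>, g); \<nu>' \<in> deg_fibre \<Lambda> (\<one>\<^bsub>Q\<^esub>, inv\<^bsub>F\<^esub> g);
        src \<Lambda> \<mu>' = rng \<Lambda> \<nu>'; cmp \<Lambda> \<mu>' \<nu>' = v\<rbrakk> \<Longrightarrow> \<mu>' = \<mu> \<and> \<nu>' = \<nu>"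
    using obj_factor[OF v g] by blast
  have "\<mu>' = \<mu>" if "\<mu>' \<in> rng_fibre \<Lambda> v (\<one>\<^bsub>Q\<^esub>, g)" for \<mu>'
  proof -
    have m': "\<mu>' \<in> deg_fibre \<Lambda> (\<one>\<^bsub>Q\<^esub>, g)" "rng \<Lambda> \<mu>' = v" "src \<Lambda> \<mu>' \<in> obj"
      using that by (auto simp: rng_fibre_def deg_fibre_def src_closed deg_obj)
    obtain \<alpha> where "\<alpha> \<in> rng_fibre \<Lambda> (src \<Lambda> \<mu>') (\<one>\<^bsub>Q\<^esub>, inv\<^bsub>F\<^esub> g)"
      using obj_factor[OF m'(3) F.inv_closed[OF g]] by blast
    then have a: "\<alpha> \<in> deg_fibre \<Lambda> (\<one>\<^bsub>Q\<^esub>, inv\<^bsub>F\<^esub> g)" "src \<Lambda> \<mu>' = rng \<Lambda> \<alpha>"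
      by (auto simp: rng_fibre_def)
    show ?thesis using un[OF m'(1) a] cmp_inverse_degree(1)[OF m'(1) a g] m'(2) by simp
  qed
  with m show ?thesis by (intro is_singletonI') auto
qed

text \<open>The mirror image: v is factored with -g in place of g, which gives the second factor
  degree (0, g), and a competitor is preceded rather than followed by \<alpha>.\<close>

lemma src_fibre_singleton:
  assumes v: "v \<in> obj" and g: "g \<in> carrier F"
  shows "is_singleton (src_fibre \<Lambda> (\<one>\<^bsub>Q\<^esub>, g) v)"
proof -
  have g': "inv\<^bsub>F\<^esub> g \<in> carrier F" "inv\<^bsub>F\<^esub> (inv\<^bsub>F\<^esub> g) = g" using g by simp_all
  obtain \<mu> \<nu> where m: "\<nu> \<in> src_fibre \<Lambda> (\<one>\<^bsub>Q\<^esub>, g) v"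
    and un: "\<And>\<mu>' \<nu>'. \<lbrakk>\<mu>' \<in> deg_fibre \<Lambda> (\<one>\<^bsub>Q\<^esub>, inv\<^bsub>F\<^esub> g); \<nu>' \<in> deg_fibre \<Lambda> (\<one>\<^bsub>Q\<^esub>, g);
        src \<Lambda> \<mu>' = rng \<Lambda> \<nu>'; cmp \<Lambda> \<mu>' \<nu>' = v\<rbrakk> \<Longrightarrow> \<mu>' = \<mu> \<and> \<nu>' = \<nu>"
    using obj_factor[OF v g'(1), unfolded g'(2)] by blast
  have "\<nu>' = \<nu>" if "\<nu>' \<in> src_fibre \<Lambda> (\<one>\<^bsub>Q\<^esub>, g) v" for \<nu>'
  proof -
    have m': "\<nu>' \<in> deg_fibre \<Lambda> (\<one>\<^bsub>Q\<^esub>, g)" "src \<Lambda> \<nu>' = v" "rng \<Lambda> \<nu>' \<in> obj"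
      using that by (auto simp: src_fibre_def deg_fibre_def rng_closed deg_obj)
    obtain \<alpha> where "\<alpha> \<in> src_fibre \<Lambda> (\<one>\<^bsub>Q\<^esub>, inv\<^bsub>F\<^esub> g) (rng \<Lambda> \<nu>')"
      using obj_factor[OF m'(3) g] by blast
    then have a: "\<alpha> \<in> deg_fibre \<Lambda> (\<one>\<^bsub>Q\<^esub>, inv\<^bsub>F\<^esub> g)" "src \<Lambda> \<alpha> = rng \<Lambda> \<nu>'"
      by (auto simp: src_fibre_def)
    show ?thesis using un[OF a(1) m'(1) a(2)] cmp_inverse_degree(2)[OF a(1) _ a(2) g'(1)] m' g'(2)
      by simp
  qed
  with m show ?thesis by (intro is_singletonI') auto
qed

section \<open>The invertible elements u_g(v) and their composition law\<close>

definition u :: "'f \<Rightarrow> 'a \<Rightarrow> 'a" where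
  "u g v = the_elem (rng_fibre \<Lambda> v (\<one>\<^bsub>Q\<^esub>, g))"

lemma rng_fibre_eq:
  "\<lbrakk>v \<in> obj; g \<in> carrier F\<rbrakk> \<Longrightarrow> rng_fibre \<Lambda> v (\<one>\<^bsub>Q\<^esub>, g) = {u g v}"
  using rng_fibre_singleton[of v g] unfolding u_def by (simp add: is_singleton_the_elem)

lemma u:
  assumes "v \<in> obj" "g \<in> carrier F"
  shows "u g v \<in> mor \<Lambda>" "deg \<Lambda> (u g v) = (\<one>\<^bsub>Q\<^esub>, g)" "rng \<Lambda> (u g v) = v" "src \<Lambda> (u g v) \<in> obj"
proof -
  have "u g v \<in> rng_fibre \<Lambda> v (\<one>\<^bsub>Q\<^esub>, g)" using rng_fibre_eq[OF assms] by simp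
  then show "u g v \<in> mor \<Lambda>" "deg \<Lambda> (u g v) = (\<one>\<^bsub>Q\<^esub>, g)" "rng \<Lambda> (u g v) = v"
    "src \<Lambda> (u g v) \<in> obj"
    by (auto simp: rng_fibre_def deg_fibre_def src_closed deg_obj)
qed

text \<open>The tool for all identities between such elements: comparing degree and range is
  enough.\<close>

lemma u_eqI:
  "\<lbrakk>x \<in> mor \<Lambda>; deg \<Lambda> x = (\<one>\<^bsub>Q\<^esub>, g); rng \<Lambda> x = v\<rbrakk> \<Longrightarrow> x = u g v"
  using rng_fibre_eq[OF obj_rng[of x], of g] snd_deg_closed[of x]
  by (auto simp: rng_fibre_def deg_fibre_def)

lemma u_one: "v \<in> obj \<Longrightarrow> u \<one>\<^bsub>F\<^esub> v = v"
  by (rule u_eqI[symmetric]) (simp_all add: objD, simp add: deg_fibre_def)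

text \<open>Both sides have degree (0, g + h) and range v.\<close>

lemma u_mult:
  assumes "v \<in> obj" "g \<in> carrier F" "h \<in> carrier F"
  shows "cmp \<Lambda> (u g v) (u h (src \<Lambda> (u g v))) = u (g \<otimes>\<^bsub>F\<^esub> h) v"
  by (rule u_eqI) (use assms in \<open>simp_all add: u cmp_closed deg_comp rng_cmp\<close>)

lemma src_u_mult:
  assumes "v \<in> obj" "g \<in> carrier F" "h \<in> carrier F"
  shows "src \<Lambda> (u h (src \<Lambda> (u g v))) = src \<Lambda> (u (g \<otimes>\<^bsub>F\<^esub> h) v)"
  using assms by (simp add: u_mult[symmetric] src_cmp u)

text \<open>By the composition law v \<mapsto> s(u_g(v)) moves objects additively in g, so the moves
  by g and -g undo each other.\<close>

lemma src_u_inverse: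
  assumes "v \<in> obj" "g \<in> carrier F"
  shows "src \<Lambda> (u (inv\<^bsub>F\<^esub> g) (src \<Lambda> (u g v))) = v" "src \<Lambda> (u g (src \<Lambda> (u (inv\<^bsub>F\<^esub> g) v))) = v"
  using assms by (simp_all add: src_u_mult u_one objD)

lemma u_inverse:
  assumes "v \<in> obj" "g \<in> carrier F"
  shows "cmp \<Lambda> (u g v) (u (inv\<^bsub>F\<^esub> g) (src \<Lambda> (u g v))) = v"
    "cmp \<Lambda> (u (inv\<^bsub>F\<^esub> g) v) (u g (src \<Lambda> (u (inv\<^bsub>F\<^esub> g) v))) = v"
    "cmp \<Lambda> (u (inv\<^bsub>F\<^esub> g) (src \<Lambda> (u g v))) (u g v) = src \<Lambda> (u g v)"
proof -
  show "cmp \<Lambda> (u g v) (u (inv\<^bsub>F\<^esub> g) (src \<Lambda> (u g v))) = v"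
    "cmp \<Lambda> (u (inv\<^bsub>F\<^esub> g) v) (u g (src \<Lambda> (u (inv\<^bsub>F\<^esub> g) v))) = v"
    using assms by (simp_all add: u_mult u_one)
  show "cmp \<Lambda> (u (inv\<^bsub>F\<^esub> g) (src \<Lambda> (u g v))) (u g v) = src \<Lambda> (u g v)"
    \<comment> \<open>From the object s(u_g(v)) the move by -g leads back to v, so the second factor
      of the law is u_g(v) itself.\<close>
    using u_mult[of "src \<Lambda> (u g v)" "inv\<^bsub>F\<^esub> g" g] assms
    by (simp add: u src_u_inverse u_one)
qed

section \<open>The action of F on the subgraph\<close>

text \<open>Restricted to \<open>mor \<Gamma>\<close> because \<open>BijGroup\<close> consists of extensional functions.\<close>

definition \<rho> :: "'f \<Rightarrow> 'a \<Rightarrow> 'a" where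
  "\<rho> g = (\<lambda>l \<in> mor \<Gamma>.
     cmp \<Lambda> (u (inv\<^bsub>F\<^esub> g) (src \<Lambda> (u g (rng \<Lambda> l)))) (cmp \<Lambda> l (u g (src \<Lambda> l))))"

text \<open>The components -g and g of the conjugating factors cancel, so the degree is kept. The
  last equation is the intertwining relation: composing with u_g(r(l)) on the left cancels the
  inverse inside \<rho>_g(l).\<close>

lemma \<rho>:
  assumes l: "l \<in> mor \<Gamma>" and g: "g \<in> carrier F"
  shows "\<rho> g l \<in> mor \<Gamma>" "deg \<Lambda> (\<rho> g l) = deg \<Lambda> l"
    "rng \<Lambda> (\<rho> g l) = src \<Lambda> (u g (rng \<Lambda> l))" "src \<Lambda> (\<rho> g l) = src \<Lambda> (u g (src \<Lambda> l))"
    "cmp \<Lambda> (u g (rng \<Lambda> l)) (\<rho> g l) = cmp \<Lambda> l (u g (src \<Lambda> l))"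
proof -
  define v where "v = rng \<Lambda> l"
  define w where "w = src \<Lambda> l"
  \<comment> \<open>\<open>a\<close> is the inverse of u_g(v); then \<rho>_g(l) is the composite of
    \<open>a\<close> and \<open>b\<close>.\<close>
  define a where "a = u (inv\<^bsub>F\<^esub> g) (src \<Lambda> (u g v))"
  define b where "b = cmp \<Lambda> l (u g w)"
  have l': "l \<in> mor \<Lambda>" "deg \<Lambda> l = (fst (deg \<Lambda> l), \<one>\<^bsub>F\<^esub>)"
    using l by (auto simp: mor_\<Gamma>_iff prod_eq_iff)
  have vw: "v \<in> obj" "w \<in> obj" using l' by (simp_all add: v_def w_def obj_rng obj_src)
  have a: "a \<in> mor \<Lambda>" "rng \<Lambda> a = src \<Lambda> (u g v)" "src \<Lambda> a = v" "deg \<Lambda> a = (\<one>\<^bsub>Q\<^esub>, inv\<^bsub>F\<^esub> g)"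
    using vw g by (simp_all add: a_def u src_u_inverse)
  have b: "b \<in> mor \<Lambda>" "rng \<Lambda> b = v" "src \<Lambda> b = src \<Lambda> (u g w)"
    "deg \<Lambda> b = (fst (deg \<Lambda> l), g)"
    using vw g l' fst_deg_closed[of l]
    by (simp_all add: b_def u cmp_closed rng_cmp src_cmp deg_comp w_def v_def mor_\<Gamma>_iff[THEN iffD1, OF l])
  have r: "\<rho> g l = cmp \<Lambda> a b" using l by (simp add: \<rho>_def a_def b_def v_def w_def)
  show "deg \<Lambda> (\<rho> g l) = deg \<Lambda> l" using a b g l' fst_deg_closed[of l]
    by (simp add: r deg_comp prod_eq_iff mor_\<Gamma>_iff[THEN iffD1, OF l])
  then show "\<rho> g l \<in> mor \<Gamma>" using a b l by (simp add: r mor_\<Gamma>_iff cmp_closed)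
  show "rng \<Lambda> (\<rho> g l) = src \<Lambda> (u g (rng \<Lambda> l))" "src \<Lambda> (\<rho> g l) = src \<Lambda> (u g (src \<Lambda> l))"
    using a b by (simp_all add: r rng_cmp src_cmp v_def w_def)
  have "cmp \<Lambda> (u g v) (cmp \<Lambda> a b) = cmp \<Lambda> (cmp \<Lambda> (u g v) a) b"
    using a b u[OF vw(1) g] by (simp add: cmp_assoc)
  also have "\<dots> = b" using u_inverse(1)[OF vw(1) g] b cmp_rng[of b] by (simp add: a_def)
  finally show "cmp \<Lambda> (u g (rng \<Lambda> l)) (\<rho> g l) = cmp \<Lambda> l (u g (src \<Lambda> l))"
    by (simp add: r b_def v_def w_def)
qed

text \<open>Compose on the left with the inverse of u_g(v).\<close>

lemma u_cancel:
  assumes "v \<in> obj" "g \<in> carrier F" "x \<in> mor \<Lambda>" "y \<in> mor \<Lambda>"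
    "rng \<Lambda> x = src \<Lambda> (u g v)" "rng \<Lambda> y = src \<Lambda> (u g v)" "cmp \<Lambda> (u g v) x = cmp \<Lambda> (u g v) y"
  shows "x = y"
proof -
  let ?a = "u (inv\<^bsub>F\<^esub> g) (src \<Lambda> (u g v))"
  have *: "cmp \<Lambda> ?a (cmp \<Lambda> (u g v) z) = z" if "z \<in> mor \<Lambda>" "rng \<Lambda> z = src \<Lambda> (u g v)" for z
  proof -
    have "cmp \<Lambda> ?a (cmp \<Lambda> (u g v) z) = cmp \<Lambda> (cmp \<Lambda> ?a (u g v)) z"
      using that assms by (subst cmp_assoc) (simp_all add: u src_u_inverse)
    then show ?thesis using that assms cmp_rng[of z] by (simp add: u_inverse)
  qed
  show ?thesis using *[OF assms(3,5)] *[OF assms(4,6)] assms(7) by metis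
qed

text \<open>By cancellation the intertwining relation determines \<rho>_g(l), so the laws of the
  action can be proved by verifying that relation.\<close>

lemma \<rho>_eqI:
  assumes "l \<in> mor \<Gamma>" "g \<in> carrier F" "x \<in> mor \<Lambda>" "rng \<Lambda> x = src \<Lambda> (u g (rng \<Lambda> l))"
    "cmp \<Lambda> (u g (rng \<Lambda> l)) x = cmp \<Lambda> l (u g (src \<Lambda> l))"
  shows "\<rho> g l = x"
  using u_cancel[of "rng \<Lambda> l" g "\<rho> g l" x] assms \<rho>[OF assms(1,2)]
  by (metis mor_\<Gamma>_D obj_rng)

lemma \<rho>_one: "l \<in> mor \<Gamma> \<Longrightarrow> \<rho> \<one>\<^bsub>F\<^esub> l = l"
  by (rule \<rho>_eqI) (auto dest!: mor_\<Gamma>_D simp: u_one obj_rng obj_src src_rng cmp_rng cmp_src)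

lemma \<rho>_mult:
  assumes l: "l \<in> mor \<Gamma>" and g: "g \<in> carrier F" and h: "h \<in> carrier F"
  shows "\<rho> g (\<rho> h l) = \<rho> (g \<otimes>\<^bsub>F\<^esub> h) l"
proof -
  define v w m n where "v = rng \<Lambda> l" "w = src \<Lambda> l" "m = \<rho> h l" "n = \<rho> g m"
  have l': "l \<in> mor \<Lambda>" "v \<in> obj" "w \<in> obj"
    using l by (auto simp: mor_\<Gamma>_iff v_w_m_n_def obj_rng obj_src)
  have m: "m \<in> mor \<Gamma>" "m \<in> mor \<Lambda>" "rng \<Lambda> m = src \<Lambda> (u h v)" "src \<Lambda> m = src \<Lambda> (u h w)"
    "cmp \<Lambda> (u h v) m = cmp \<Lambda> l (u h w)"
    using \<rho>[OF l h] by (auto simp: v_w_m_n_def mor_\<Gamma>_D)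
  have n: "n \<in> mor \<Lambda>" "rng \<Lambda> n = src \<Lambda> (u g (rng \<Lambda> m))"
    "cmp \<Lambda> (u g (rng \<Lambda> m)) n = cmp \<Lambda> m (u g (src \<Lambda> m))"
    using \<rho>[OF m(1) g] by (auto simp: v_w_m_n_def mor_\<Gamma>_D)
  note uv = u[OF l'(2) h] and uw = u[OF l'(3) h]
  note uv' = u[OF uv(4) g] and uw' = u[OF uw(4) g]
  \<comment> \<open>Moving u_h past l and then u_g past \<rho>_h(l) yields the index h + g;
    commutativity of F restores g + h at the end.\<close>
  have "\<rho> (h \<otimes>\<^bsub>F\<^esub> g) l = n"
  proof (rule \<rho>_eqI)
    show "rng \<Lambda> n = src \<Lambda> (u (h \<otimes>\<^bsub>F\<^esub> g) (rng \<Lambda> l))"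
      using n(2) m(3) l' g h by (simp add: src_u_mult v_w_m_n_def(1))
    have "cmp \<Lambda> (u (h \<otimes>\<^bsub>F\<^esub> g) v) n = cmp \<Lambda> (cmp \<Lambda> (u h v) (u g (src \<Lambda> (u h v)))) n"
      using l' g h by (simp add: u_mult)
    also have "\<dots> = cmp \<Lambda> (u h v) (cmp \<Lambda> m (u g (src \<Lambda> m)))"
      using n m uv uv' by (simp add: cmp_assoc)
    also have "\<dots> = cmp \<Lambda> (cmp \<Lambda> l (u h w)) (u g (src \<Lambda> (u h w)))"
      using m uv uw uw' by (simp add: cmp_assoc[symmetric])
    also have "\<dots> = cmp \<Lambda> l (u (h \<otimes>\<^bsub>F\<^esub> g) w)"
      using l' uw uw' g h by (simp add: cmp_assoc u_mult v_w_m_n_def(2)[symmetric])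
    finally show "cmp \<Lambda> (u (h \<otimes>\<^bsub>F\<^esub> g) (rng \<Lambda> l)) n = cmp \<Lambda> l (u (h \<otimes>\<^bsub>F\<^esub> g) (src \<Lambda> l))"
      by (simp add: v_w_m_n_def)
  qed (use l g h n in auto)
  then show ?thesis using g h by (simp add: F.m_comm v_w_m_n_def)
qed

lemma \<rho>_inv: "\<lbrakk>l \<in> mor \<Gamma>; g \<in> carrier F\<rbrakk> \<Longrightarrow> \<rho> g (\<rho> (inv\<^bsub>F\<^esub> g) l) = l"
  by (simp add: \<rho>_mult \<rho>_one)

lemma bij_\<rho>: "g \<in> carrier F \<Longrightarrow> bij_betw (\<rho> g) (mor \<Gamma>) (mor \<Gamma>)"
  by (rule bij_betwI[where g = "\<rho> (inv\<^bsub>F\<^esub> g)"]) (auto simp: \<rho> \<rho>_mult \<rho>_one)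

lemma graph_iso_\<rho>:
  assumes g: "g \<in> carrier F" shows "graph_iso \<Gamma> \<Gamma> (\<rho> g)"
proof -
  \<comment> \<open>For an identity v the intertwining relation is met by s(u_g(v)), both sides
    being u_g(v). Hence \<rho>_g commutes with range and source.\<close>
  have "\<rho> g v = src \<Lambda> (u g v)" if "v \<in> obj" for v
  proof (rule \<rho>_eqI)
    show "v \<in> mor \<Gamma>" using that objD obj_\<Gamma> by metis
  qed (use that g objD[OF that] u[OF that g] in \<open>auto simp: rng_src src_closed\<close>,
      metis cmp_rng cmp_src)
  then have o: "\<rho> g (rng \<Lambda> l) = rng \<Lambda> (\<rho> g l)" "\<rho> g (src \<Lambda> l) = src \<Lambda> (\<rho> g l)" if "l \<in> mor \<Gamma>" for l
    using that g by (simp_all add: \<rho> obj_rng obj_src mor_\<Gamma>_D)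
  have "\<rho> g (cmp \<Lambda> \<mu> \<nu>) = cmp \<Lambda> (\<rho> g \<mu>) (\<rho> g \<nu>)"
    if m: "\<mu> \<in> mor \<Gamma>" and n: "\<nu> \<in> mor \<Gamma>" and c: "src \<Lambda> \<mu> = rng \<Lambda> \<nu>" for \<mu> \<nu>
  proof (rule \<rho>_eqI)
    note \<mu> = \<rho>[OF m g] and \<nu> = \<rho>[OF n g]
    have M: "\<mu> \<in> mor \<Lambda>" "\<nu> \<in> mor \<Lambda>" "\<rho> g \<mu> \<in> mor \<Lambda>" "\<rho> g \<nu> \<in> mor \<Lambda>"
      using m n \<mu>(1) \<nu>(1) by (simp_all add: mor_\<Gamma>_D)
    have c': "src \<Lambda> (\<rho> g \<mu>) = rng \<Lambda> (\<rho> g \<nu>)" using \<mu> \<nu> c by simp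
    show "cmp \<Lambda> \<mu> \<nu> \<in> mor \<Gamma>" using that by (rule cmp_\<Gamma>)
    show "cmp \<Lambda> (\<rho> g \<mu>) (\<rho> g \<nu>) \<in> mor \<Lambda>" using M c' by (simp add: cmp_closed)
    show "rng \<Lambda> (cmp \<Lambda> (\<rho> g \<mu>) (\<rho> g \<nu>)) = src \<Lambda> (u g (rng \<Lambda> (cmp \<Lambda> \<mu> \<nu>)))"
      using M c c' \<mu> by (simp add: rng_cmp)
    note U = u[OF obj_rng[OF M(1)] g] u[OF obj_rng[OF M(2)] g] u[OF obj_src[OF M(2)] g]
    \<comment> \<open>u_g is pushed first past \<mu> and then past \<nu>, using one intertwining
      relation for each.\<close>
    have "cmp \<Lambda> (u g (rng \<Lambda> \<mu>)) (cmp \<Lambda> (\<rho> g \<mu>) (\<rho> g \<nu>))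
        = cmp \<Lambda> (cmp \<Lambda> \<mu> (u g (rng \<Lambda> \<nu>))) (\<rho> g \<nu>)"
      using M c c' \<mu> U by (simp add: cmp_assoc[symmetric])
    also have "\<dots> = cmp \<Lambda> \<mu> (cmp \<Lambda> \<nu> (u g (src \<Lambda> \<nu>)))"
      using M c \<nu> U by (simp add: cmp_assoc)
    also have "\<dots> = cmp \<Lambda> (cmp \<Lambda> \<mu> \<nu>) (u g (src \<Lambda> \<nu>))"
      using M c U by (simp add: cmp_assoc)
    finally show "cmp \<Lambda> (u g (rng \<Lambda> (cmp \<Lambda> \<mu> \<nu>))) (cmp \<Lambda> (\<rho> g \<mu>) (\<rho> g \<nu>))
        = cmp \<Lambda> (cmp \<Lambda> \<mu> \<nu>) (u g (src \<Lambda> (cmp \<Lambda> \<mu> \<nu>)))"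
      using M c by (simp add: rng_cmp src_cmp)
  qed (rule g)
  with o show ?thesis using g by (simp add: graph_iso_def bij_\<rho> \<rho>)
qed

lemma graph_action_\<rho>: "graph_action F \<Gamma> \<rho>"
proof -
  have B: "\<rho> g \<in> Bij (mor \<Gamma>)" if "g \<in> carrier F" for g
    using bij_\<rho>[OF that] by (simp add: Bij_def \<rho>_def)
  \<comment> \<open>Both sides are extensional on \<open>mor \<Gamma>\<close>, so agreement there
    gives equality of functions.\<close>
  have "\<rho> (g \<otimes>\<^bsub>F\<^esub> h) = compose (mor \<Gamma>) (\<rho> g) (\<rho> h)" if "g \<in> carrier F" "h \<in> carrier F" for g h
    using that by (intro extensionalityI[of _ "mor \<Gamma>"])
      (auto simp: compose_eq \<rho>_mult, simp add: \<rho>_def)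
  then have "\<rho> \<in> hom F (BijGroup (mor \<Gamma>))"
    using B by (intro homI) (auto simp: BijGroup_def)
  then have "group_action F (mor \<Gamma>) \<rho>"
    unfolding group_action_def group_hom_def group_hom_axioms_def
    using F.is_group group_BijGroup by blast
  then show ?thesis by (simp add: graph_action_def graph_iso_\<rho>)
qed

section \<open>The isomorphism with the crossed product\<close>

text \<open>The sign comes from moving u_g to the right: the intertwining relation for
  \<rho>_{-g}(m) reads u_g m = \<rho>_{-g}(m) u_g, so the crossed product must twist by
  \<rho>_{-g}.\<close>

abbreviation "\<sigma> \<equiv> \<lambda>g. \<rho> (inv\<^bsub>F\<^esub> g)"

definition \<phi> :: "'a \<Rightarrow> 'a \<times> 'f" where
  "\<phi> l = (cmp \<Lambda> l (u (inv\<^bsub>F\<^esub> (snd (deg \<Lambda> l))) (src \<Lambda> l)), snd (deg \<Lambda> l))"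

text \<open>Take l to be x composed with u_{-g}(s(x)), where g is the F-component of the degree of
  x. Composing with u_g then restores x.\<close>

lemma decompose:
  assumes x: "x \<in> mor \<Lambda>"
  obtains l g where "l \<in> mor \<Gamma>" "g \<in> carrier F" "x = cmp \<Lambda> l (u g (src \<Lambda> l))"
proof -
  define g where "g = snd (deg \<Lambda> x)"
  define v where "v = src \<Lambda> x"
  define a where "a = u (inv\<^bsub>F\<^esub> g) v"
  have g: "g \<in> carrier F" using x by (simp add: g_def snd_deg_closed)
  have v: "v \<in> obj" using x by (simp add: v_def obj_src)
  have a: "a \<in> mor \<Lambda>" "deg \<Lambda> a = (\<one>\<^bsub>Q\<^esub>, inv\<^bsub>F\<^esub> g)" "rng \<Lambda> a = src \<Lambda> x" "src \<Lambda> a \<in> obj"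
    using u[OF v F.inv_closed[OF g]] by (simp_all add: a_def v_def)
  note b = u[OF a(4) g]
  have s: "src \<Lambda> (cmp \<Lambda> x a) = src \<Lambda> a" using x a by (simp add: src_cmp)
  have "cmp \<Lambda> (cmp \<Lambda> x a) (u g (src \<Lambda> a)) = cmp \<Lambda> x (cmp \<Lambda> a (u g (src \<Lambda> a)))"
    using x a b by (simp add: cmp_assoc)
  also have "\<dots> = x" using u_inverse(2)[OF v g] x by (simp add: a_def v_def cmp_src)
  finally have "x = cmp \<Lambda> (cmp \<Lambda> x a) (u g (src \<Lambda> (cmp \<Lambda> x a)))" using s by simp
  moreover have "cmp \<Lambda> x a \<in> mor \<Gamma>"
    using x a g by (simp add: mor_\<Gamma>_iff cmp_closed deg_comp g_def[symmetric])
  ultimately show ?thesis using that g by blast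
qed

text \<open>The source is stated through \<rho>_g because the crossed product by \<sigma> uses
  \<sigma>_{-g} = \<rho>_g in its source map.\<close>

lemma compound:
  assumes l: "l \<in> mor \<Gamma>" and g: "g \<in> carrier F"
  defines "x \<equiv> cmp \<Lambda> l (u g (src \<Lambda> l))"
  shows "x \<in> mor \<Lambda>" "deg \<Lambda> x = (fst (deg \<Lambda> l), g)" "rng \<Lambda> x = rng \<Lambda> l"
    "src \<Lambda> x = src \<Lambda> (\<rho> g l)" "\<phi> x = (l, g)"
proof -
  have l': "l \<in> mor \<Lambda>" "snd (deg \<Lambda> l) = \<one>\<^bsub>F\<^esub>" "src \<Lambda> l \<in> obj"
    using l by (simp_all add: mor_\<Gamma>_iff obj_src)
  note U = u[OF l'(3) g]
  show "x \<in> mor \<Lambda>" "rng \<Lambda> x = rng \<Lambda> l" and s: "src \<Lambda> x = src \<Lambda> (\<rho> g l)"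
    using l' U \<rho>[OF l g] by (simp_all add: x_def cmp_closed rng_cmp src_cmp)
  show d: "deg \<Lambda> x = (fst (deg \<Lambda> l), g)"
    using l' U g fst_deg_closed by (simp add: x_def deg_comp)
  note V = u[OF U(4) F.inv_closed[OF g]]
  have "cmp \<Lambda> x (u (inv\<^bsub>F\<^esub> g) (src \<Lambda> (u g (src \<Lambda> l))))
      = cmp \<Lambda> l (cmp \<Lambda> (u g (src \<Lambda> l)) (u (inv\<^bsub>F\<^esub> g) (src \<Lambda> (u g (src \<Lambda> l)))))"
    using l' U V by (simp add: x_def cmp_assoc)
  also have "\<dots> = l" using u_inverse(1)[OF l'(3) g] l' by (simp add: cmp_src)
  finally show "\<phi> x = (l, g)" using s d \<rho>[OF l g] by (simp add: \<phi>_def)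
qed

text \<open>Put n = \<sigma>_g(m), so that \<rho>_g(n) = m. Then l u_g m u_h = l n u_g u_h by the
  intertwining relation for n, and u_g u_h merges into u_{g+h}.\<close>

lemma compound_cmp:
  assumes l: "l \<in> mor \<Gamma>" and g: "g \<in> carrier F" and m: "m \<in> mor \<Gamma>" and h: "h \<in> carrier F"
    and c: "src \<Lambda> (\<rho> g l) = rng \<Lambda> m"
  shows "src \<Lambda> l = rng \<Lambda> (\<sigma> g m)"
    and "cmp \<Lambda> (cmp \<Lambda> l (u g (src \<Lambda> l))) (cmp \<Lambda> m (u h (src \<Lambda> m)))
      = cmp \<Lambda> (cmp \<Lambda> l (\<sigma> g m)) (u (g \<otimes>\<^bsub>F\<^esub> h) (src \<Lambda> (cmp \<Lambda> l (\<sigma> g m))))"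
proof -
  define n where "n = \<sigma> g m"
  have n: "n \<in> mor \<Gamma>" "\<rho> g n = m" using m g by (simp_all add: n_def \<rho> \<rho>_inv)
  have M: "l \<in> mor \<Lambda>" "m \<in> mor \<Lambda>" "n \<in> mor \<Lambda>" using l m n by (simp_all add: mor_\<Gamma>_D)
  note O = obj_rng[OF M(1)] obj_src[OF M(1)] obj_rng[OF M(2)] obj_src[OF M(2)]
    obj_rng[OF M(3)] obj_src[OF M(3)]
  note rn = \<rho>[OF n(1) g, unfolded n(2)]
  \<comment> \<open>r(n) is r(m) moved by -g, and r(m) = s(\<rho>_g(l)) is s(l) moved by g.\<close>
  have "rng \<Lambda> n = src \<Lambda> (u (inv\<^bsub>F\<^esub> g) (rng \<Lambda> m))" using m g by (simp add: n_def \<rho>)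
  also have "\<dots> = src \<Lambda> l" using c l g O by (simp add: \<rho> src_u_inverse flip: c)
  finally have c': "src \<Lambda> l = rng \<Lambda> n" by simp
  then show "src \<Lambda> l = rng \<Lambda> (\<sigma> g m)" by (simp add: n_def)
  note U = u[OF O(5) g] u[OF O(6) g] u[OF O(4) h]
  have "cmp \<Lambda> (cmp \<Lambda> l (u g (src \<Lambda> l))) (cmp \<Lambda> m (u h (src \<Lambda> m)))
      = cmp \<Lambda> l (cmp \<Lambda> (cmp \<Lambda> (u g (rng \<Lambda> n)) m) (u h (src \<Lambda> m)))"
    using M U c' rn(3) by (simp add: cmp_assoc cmp_closed rng_cmp src_cmp)
  also have "\<dots> = cmp \<Lambda> l (cmp \<Lambda> (cmp \<Lambda> n (u g (src \<Lambda> n))) (u h (src \<Lambda> m)))"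
    by (simp add: rn(5))
  also have "\<dots> = cmp \<Lambda> l (cmp \<Lambda> n (u (g \<otimes>\<^bsub>F\<^esub> h) (src \<Lambda> n)))"
    using M U rn(4) O g h by (simp add: cmp_assoc u_mult)
  also have "\<dots> = cmp \<Lambda> (cmp \<Lambda> l n) (u (g \<otimes>\<^bsub>F\<^esub> h) (src \<Lambda> (cmp \<Lambda> l n)))"
    using M c' u[OF O(6) F.m_closed[OF g h]] by (simp add: cmp_assoc src_cmp)
  finally show "cmp \<Lambda> (cmp \<Lambda> l (u g (src \<Lambda> l))) (cmp \<Lambda> m (u h (src \<Lambda> m)))
      = cmp \<Lambda> (cmp \<Lambda> l (\<sigma> g m)) (u (g \<otimes>\<^bsub>F\<^esub> h) (src \<Lambda> (cmp \<Lambda> l (\<sigma> g m))))"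
    by (simp add: n_def)
qed

lemma graph_iso_\<phi>: "graph_iso \<Lambda> (crossed_product F \<Gamma> \<sigma>) \<phi>"
  unfolding graph_iso_def
proof (intro conjI ballI impI)
  show "bij_betw \<phi> (mor \<Lambda>) (mor (crossed_product F \<Gamma> \<sigma>))"
  proof (rule bij_betwI[where g = "\<lambda>(l, g). cmp \<Lambda> l (u g (src \<Lambda> l))"])
    show "\<phi> \<in> mor \<Lambda> \<rightarrow> mor (crossed_product F \<Gamma> \<sigma>)"
      by (auto elim!: decompose simp: compound crossed_product_def)
    show "(\<lambda>(l, g). cmp \<Lambda> l (u g (src \<Lambda> l))) \<in> mor (crossed_product F \<Gamma> \<sigma>) \<rightarrow> mor \<Lambda>"
      by (auto simp: compound crossed_product_def)
    show "(case \<phi> x of (l, g) \<Rightarrow> cmp \<Lambda> l (u g (src \<Lambda> l))) = x" if "x \<in> mor \<Lambda>" for x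
      using that by (auto elim!: decompose simp: compound)
    show "\<phi> (case y of (l, g) \<Rightarrow> cmp \<Lambda> l (u g (src \<Lambda> l))) = y"
      if "y \<in> mor (crossed_product F \<Gamma> \<sigma>)" for y
      using that by (auto simp: compound crossed_product_def)
  qed
next
  have \<phi>_obj: "\<phi> v = (v, \<one>\<^bsub>F\<^esub>)" if "v \<in> obj" for v
    using that objD[OF that] cmp_src[of v] by (simp add: \<phi>_def deg_fibre_def u_one[OF that])
  fix x assume x: "x \<in> mor \<Lambda>"
  then obtain l g where l: "l \<in> mor \<Gamma>" "g \<in> carrier F" and xl: "x = cmp \<Lambda> l (u g (src \<Lambda> l))"
    by (rule decompose)
  note C = compound[OF l, folded xl]
  show "rng (crossed_product F \<Gamma> \<sigma>) (\<phi> x) = \<phi> (rng \<Lambda> x)"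
    "src (crossed_product F \<Gamma> \<sigma>) (\<phi> x) = \<phi> (src \<Lambda> x)"
    "deg (crossed_product F \<Gamma> \<sigma>) (\<phi> x) = deg \<Lambda> x"
    using C(2-5) l \<phi>_obj[OF obj_rng[OF x]] \<phi>_obj[OF obj_src[OF x]]
    by (simp_all add: crossed_product_def)
  fix y assume y: "y \<in> mor \<Lambda>" "src \<Lambda> x = rng \<Lambda> y"
  then obtain m h where m: "m \<in> mor \<Gamma>" "h \<in> carrier F" and ym: "y = cmp \<Lambda> m (u h (src \<Lambda> m))"
    by (metis decompose)
  note D = compound[OF m, folded ym]
  have "src \<Lambda> (\<rho> g l) = rng \<Lambda> m" using y C D by simp
  note E = compound_cmp[OF l m this, folded xl ym]
  \<comment> \<open>The composite of x and y is l' u_{g+h}(s(l')) with l' = l \<sigma>_g(m). As l'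
    lies in \<Gamma>, the value of \<phi> there is (l', g + h), the product of (l, g) and (m,
    h).\<close>
  have "cmp \<Lambda> l (\<sigma> g m) \<in> mor \<Gamma>" using E(1) l m by (intro cmp_\<Gamma>) (simp_all add: \<rho>)
  from compound(5)[OF this F.m_closed[OF l(2) m(2)]]
  show "\<phi> (cmp \<Lambda> x y) = cmp (crossed_product F \<Gamma> \<sigma>) (\<phi> x) (\<phi> y)"
    by (simp add: E(2) C D crossed_product_def)
qed

end

section \<open>Specialisation to degrees in N^k\<close>

lemma comm_monoid_nat_pow: "comm_monoid (nat_pow k)"
  by (rule comm_monoidI)
    (simp_all add: nat_pow_def product_group_def fun_eq_iff PiE_iff extensional_def ac_simps)

theorem theorem5p16:
  fixes k :: nat
    and F :: "('f, 'm) monoid_scheme"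
    and \<Lambda> :: "('a, (nat \<Rightarrow> nat) \<times> 'f) graded_cat"
    and \<Gamma> :: "('a, nat \<Rightarrow> nat) graded_cat"
  assumes "comm_group F" and "countable (carrier F)"
    and "P_graph (nat_pow k \<times>\<times> F) \<Lambda>"
    and "\<Gamma> = sub_k_graph k F \<Lambda>"
  shows "k_graph k \<Gamma> \<and>
    (\<forall>g \<in> carrier F. \<forall>v \<in> deg_fibre \<Lambda> \<one>\<^bsub>nat_pow k \<times>\<times> F\<^esub>.
        is_singleton (rng_fibre \<Lambda> v (\<one>\<^bsub>nat_pow k\<^esub>, g)) \<and>
        is_singleton (src_fibre \<Lambda> (\<one>\<^bsub>nat_pow k\<^esub>, g) v)) \<and>
    (\<exists>\<rho>. graph_action F \<Gamma> \<rho> \<and>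
        (\<forall>l \<in> mor \<Gamma>. \<forall>g \<in> carrier F.
           \<forall>\<mu> \<in> rng_fibre \<Lambda> (rng \<Lambda> l) (\<one>\<^bsub>nat_pow k\<^esub>, g).
           \<forall>\<nu> \<in> rng_fibre \<Lambda> (src \<Lambda> l) (\<one>\<^bsub>nat_pow k\<^esub>, g).
             src \<Lambda> \<mu> = rng \<Lambda> (\<rho> g l) \<and> cmp \<Lambda> \<mu> (\<rho> g l) = cmp \<Lambda> l \<nu>) \<and>
        P_graph (nat_pow k \<times>\<times> F) (crossed_product F \<Gamma> (\<lambda>g. \<rho> (inv\<^bsub>F\<^esub> g))) \<and>
        isomorphic_graphs \<Lambda> (crossed_product F \<Gamma> (\<lambda>g. \<rho> (inv\<^bsub>F\<^esub> g))))"
proof -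
  interpret product_graph "nat_pow k" F \<Lambda>
    using assms(1,3) comm_monoid_nat_pow by (intro product_graph.intro)
  have \<Gamma>: "\<Gamma> = product_graph.\<Gamma> (nat_pow k) F \<Lambda>"
    using assms(4) by (simp add: sub_k_graph_def \<Gamma>_def)
  show ?thesis
    unfolding \<Gamma> isomorphic_graphs_def
  proof (intro conjI ballI exI[of _ \<rho>])
    show "P_graph (nat_pow k) (product_graph.\<Gamma> (nat_pow k) F \<Lambda>)"
      by (rule P_graph_\<Gamma>)
    fix g v assume "g \<in> carrier F" "v \<in> deg_fibre \<Lambda> \<one>\<^bsub>nat_pow k \<times>\<times> F\<^esub>"
    then show "is_singleton (rng_fibre \<Lambda> v (\<one>\<^bsub>nat_pow k\<^esub>, g))"
      "is_singleton (src_fibre \<Lambda> (\<one>\<^bsub>nat_pow k\<^esub>, g) v)"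
      unfolding one_DirProd by (simp_all only: rng_fibre_singleton src_fibre_singleton)
  next
    fix l g \<mu> \<nu>
    assume l: "l \<in> mor (product_graph.\<Gamma> (nat_pow k) F \<Lambda>)" "g \<in> carrier F"
      and "\<mu> \<in> rng_fibre \<Lambda> (rng \<Lambda> l) (\<one>\<^bsub>nat_pow k\<^esub>, g)"
        "\<nu> \<in> rng_fibre \<Lambda> (src \<Lambda> l) (\<one>\<^bsub>nat_pow k\<^esub>, g)"
    \<comment> \<open>The fibres over which \<mu> and \<nu> range are singletons, so the claim
      becomes the intertwining relation for u_g.\<close>
    then have "\<mu> = u g (rng \<Lambda> l)" "\<nu> = u g (src \<Lambda> l)"
      by (auto simp: rng_fibre_eq obj_rng obj_src mor_\<Gamma>_D)
    then show "src \<Lambda> \<mu> = rng \<Lambda> (\<rho> g l)" "cmp \<Lambda> \<mu> (\<rho> g l) = cmp \<Lambda> l \<nu>"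
      using \<rho>(3,5)[OF l] by simp_all
  qed (rule graph_action_\<rho> P_graph_transport[OF assms(3) graph_iso_\<phi>] exI graph_iso_\<phi>)+
qed

end
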